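(* A typical map in $\mathcal C[0,1]$ is Lebesgue-a.e. strongly non expansive in the future.
   Context: $\mathcal C[0,1]$ is the space of continuous maps of $[0,1]$ to itself, with the uniform metric. A property is typical ("a typical map has it") if there is a dense $G_\delta$ subset $G\subset\mathcal C[0,1]$ such that all $f\in G$ have the property. A map $f\in\mathcal C[0,1]$ is Lebesgue-a.e. strongly non expansive in the future if for any real number $\alpha>0$ and for Lebesgue-a.e. $x\in[0,1]$, $$\mathrm{Leb}\big(\{y\in[0,1]:|f^n(x)-f^n(y)|<\alpha\ \ \forall n\in\mathbb N\}\big)>0.$$ *)

theory Defs
  imports "HOL-Analysis.Analysis"
begin

text \<open>
  The space of continuous self-maps of the unit interval with the uniform metric.
  Its points are functions of type \<^typ>\<open>real \<Rightarrow> real\<close> that are continuous on \<open>{0..1}\<close>, map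
  \<open>{0..1}\<close> into itself and are extensional, so that two maps agreeing on \<open>{0..1}\<close> are equal.
\<close>

definition C01 :: "(real \<Rightarrow> real) metric" where
  "C01 = cfunspace (top_of_set {0..1}) (submetric euclidean_metric {0..1})"

definition typical :: "'a topology \<Rightarrow> ('a \<Rightarrow> bool) \<Rightarrow> bool" where
  "typical X P \<longleftrightarrow>
     (\<exists>G. gdelta_in X G \<and> X closure_of G = topspace X \<and> (\<forall>f\<in>G. P f))"

text \<open>The time \<open>n\<close> ranges over all natural numbers including \<open>0\<close>.\<close>

definition strongly_non_expansive_future :: "(real \<Rightarrow> real) \<Rightarrow> bool" where
  "strongly_non_expansive_future f \<longleftrightarrow>
     (\<forall>\<alpha>>0. AE x in lebesgue_on {0..1}.
        emeasure lebesgue {y \<in> {0..1}. \<forall>n. \<bar>(f ^^ n) x - (f ^^ n) y\<bar> < \<alpha>} > 0)"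

lemma mspace_C01:
  "mspace C01 = {f. continuous_on {0..1} f \<and> f \<in> {0..1} \<rightarrow> {0..1} \<and> f \<in> extensional {0..1}}"
proof -
  have top: "mtopology_of (submetric euclidean_metric {0..1::real}) = top_of_set {0..1}"
    by (simp add: mtopology_of_submetric)
  have "mspace C01 = {f. f ` {0..1} \<subseteq> {0..1} \<and> f \<in> extensional {0..1} \<and>
      continuous_map (top_of_set {0..1}) (top_of_set {0..1}) f}"
    unfolding C01_def
    by (subst compactin_mspace_cfunspace) (auto simp: compactin_subtopology top image_subset_iff
        dest: continuous_map_image_subset_topspace)
  then show ?thesis
    by (auto simp: continuous_map_in_subtopology image_subset_iff Pi_iff)
qed

text \<open>The sets in the definition of strong non expansiveness are Borel, so \<^const>\<open>emeasure\<close>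
  does not return its default value \<open>0\<close> on them.\<close>

lemma future_ball_borel:
  assumes "f \<in> mspace C01"
  shows "{y \<in> {0..1}. \<forall>n. \<bar>(f ^^ n) x - (f ^^ n) y\<bar> < \<alpha>} \<in> sets borel"
proof -
  have f: "continuous_on {0..1} f" "f \<in> {0..1} \<rightarrow> {0..1}"
    using assms by (auto simp: mspace_C01)
  have fn: "continuous_on {0..1} (f ^^ n) \<and> (f ^^ n) \<in> {0..1} \<rightarrow> {0..1}" for n
  proof (induction n)
    case (Suc n)
    then have "continuous_on {0..1} (f \<circ> (f ^^ n))"
      using f by (intro continuous_on_compose) (auto intro: continuous_on_subset)
    with Suc f show ?case
      by (auto simp: o_def Pi_iff)
  qed (auto simp: id_def)
  have "{y \<in> {0..1}. \<bar>(f ^^ n) x - (f ^^ n) y\<bar> < \<alpha>} \<in> sets borel" for n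
  proof -
    have "openin (top_of_set {0..1})
        ({0..1} \<inter> (\<lambda>y. \<bar>(f ^^ n) x - (f ^^ n) y\<bar>) -` {..<\<alpha>})"
      using fn by (intro continuous_openin_preimage_gen) (auto intro!: continuous_intros)
    then obtain T where "open T"
      "{0..1} \<inter> (\<lambda>y. \<bar>(f ^^ n) x - (f ^^ n) y\<bar>) -` {..<\<alpha>} = {0..1} \<inter> T"
      unfolding openin_open by blast
    moreover have "{y \<in> {0..1}. \<bar>(f ^^ n) x - (f ^^ n) y\<bar> < \<alpha>} =
        {0..1} \<inter> (\<lambda>y. \<bar>(f ^^ n) x - (f ^^ n) y\<bar>) -` {..<\<alpha>}"
      by auto
    ultimately show ?thesis by simp
  qed
  then have "(\<Inter>n. {y \<in> {0..1}. \<bar>(f ^^ n) x - (f ^^ n) y\<bar> < \<alpha>}) \<in> sets borel"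
    by (intro sets.countable_INT) auto
  moreover have "(\<Inter>n. {y \<in> {0..1}. \<bar>(f ^^ n) x - (f ^^ n) y\<bar> < \<alpha>}) =
      {y \<in> {0..1}. \<forall>n. \<bar>(f ^^ n) x - (f ^^ n) y\<bar> < \<alpha>}"
    by auto
  ultimately show ?thesis by simp
qed

end

theory Submission
  imports Defs
begin

text \<open>
  Cut \<open>[0,1]\<close> into \<open>N\<close>
  equal intervals and shave a width of \<open>1/(2N\<^sup>2)\<close> off both ends of each; call what remains the cores.
  Suppose that the map sends every core into the interior of some core.  Then all points of one
  core follow the same itinerary through the cores for ever, so the distance of two of their orbits
  stays below \<open>1/N\<close>: the core, a set of positive measure, lies in the future ball of radius \<open>1/N\<close>
  of each of its points (\<open>trapping_future_ball_contains_cell\<close>).  The points outside the cores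
  have measure of order \<open>1/N\<close>.  Hence a map that is trapping in this sense for arbitrarily
  large \<open>N\<close> is strongly non expansive in the future at almost every point
  (\<open>strongly_non_expansive_if_frequently_trapping\<close>).

  Such maps are typical.  To be trapping for some \<open>N > k\<close> is an open condition, since a core is sent
  into the interior of a core with room to spare (\<open>openin_trapping\<close>).  It is also a dense one: with \<open>N\<close>
  large, a continuous \<open>f\<close> is almost constant on each core and can be changed a little so as to be
  constant there, with the centre of a core as its value; the thin gaps between the cores leave room
  to interpolate (\<open>trapping_approximation\<close>).  The space is completely metrizable, so Baire's theorem
  makes the intersection over all \<open>k\<close> of these open dense sets a dense \<open>G\<^sub>\<delta>\<close> set.
\<close>

section \<open>Cells of a uniform grid\<close>

definition cell :: "nat \<Rightarrow> real \<Rightarrow> nat \<Rightarrow> real set" where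
  "cell N m i = {real i / real N + m .. (real i + 1) / real N - m}"

abbreviation core :: "nat \<Rightarrow> nat \<Rightarrow> real set" where
  "core N \<equiv> cell N (1 / (2 * (real N)\<^sup>2))"

text \<open>
  The margin \<open>\<eta>\<close> is uniform in \<open>i\<close>; it is the radius by which such a map can be perturbed.
\<close>

definition trapping :: "nat \<Rightarrow> (real \<Rightarrow> real) \<Rightarrow> bool" where
  "trapping N f \<longleftrightarrow> (\<exists>\<eta>>0. \<forall>i<N. \<exists>j<N.
     f ` core N i \<subseteq> cell N (1 / (2 * (real N)\<^sup>2) + \<eta>) j)"

text \<open>
  The index of a cell can be read off any of its points, so a family of values indexed by
  cells defines a function on their union.
\<close>

lemma floor_of_mem_cell:
  assumes "x \<in> cell N m i" "0 < N" "0 < m"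
  shows "nat \<lfloor>real N * x\<rfloor> = i"
proof -
  have "real i / real N < x" "x < (real i + 1) / real N"
    using assms unfolding cell_def by auto
  then have "real i < real N * x" "real N * x < real i + 1"
    using assms(2) by (simp_all add: field_simps)
  then have "\<lfloor>real N * x\<rfloor> = int i"
    by (intro floor_unique) auto
  then show ?thesis by simp
qed

lemma cell_subset_unit:
  assumes "i < N" "0 \<le> m"
  shows "cell N m i \<subseteq> {0..1}"
proof -
  have "real i + 1 \<le> real N" using assms by linarith
  then have "(real i + 1) / real N \<le> 1" using assms by simp
  moreover have "0 \<le> real i / real N" by simp
  ultimately show ?thesis
    using assms unfolding cell_def atLeastatMost_subset_iff by linarith
qed

lemma unit_subset_cells_Un_gaps:
  assumes "0 < N" "0 \<le> m" "x \<in> {0..1}"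
  shows "(\<exists>i<N. x \<in> cell N m i) \<or> (\<exists>i\<le>N. x \<in> cball (real i / real N) m)"
proof (rule ccontr)
  assume neg: "\<not> ?thesis"
  define i where "i = nat \<lfloor>real N * x\<rfloor>"
  have "real i \<le> real N * x" "real N * x < real i + 1"
    using assms unfolding i_def by (auto simp: of_nat_nat)
  then have lo: "real i / real N \<le> x" and hi: "x \<le> (real i + 1) / real N"
    using assms by (simp_all add: field_simps)
  have "real N * x \<le> real N" using assms by (simp add: mult_left_le)
  with \<open>real i \<le> real N * x\<close> have "i \<le> N" by linarith
  with neg have A: "x \<notin> cball (real i / real N) m" by blast
  then have A': "real i / real N + m < x" using lo by (auto simp: dist_real_def)
  show False
  proof (cases "i = N")
    case True
    with assms lo have "x = real i / real N" by simp
    with A assms show False by simp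
  next
    case False
    with \<open>i \<le> N\<close> have "i < N" "Suc i \<le> N" by auto
    with neg have B: "x \<notin> cell N m i" and C: "x \<notin> cball (real (Suc i) / real N) m" by blast+
    from B A' have "(real i + 1) / real N - m < x" unfolding cell_def by auto
    with C hi show False by (auto simp: dist_real_def add.commute)
  qed
qed

text \<open>
  The \<open>N + 1\<close> gaps of length \<open>1/N\<^sup>2\<close> have total length at most \<open>2/N\<close>, which is arbitrarily small.
\<close>

lemma negligible_if_covered_by_gaps:
  assumes "\<And>k. \<exists>N>k. B \<subseteq> (\<Union>i\<le>N. cball (real i / real N) (1 / (2 * (real N)\<^sup>2)))"
  shows "negligible B"
proof (rule negligible_outer_le[THEN iffD2], intro allI impI)
  fix e :: real assume "e > 0"
  then obtain k where k: "2 / real (Suc k) < e"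
    using reals_Archimedean[of "e / 2"] by (auto simp: field_simps)
  obtain N where N: "N > Suc k"
    and B: "B \<subseteq> (\<Union>i\<le>N. cball (real i / real N) (1 / (2 * (real N)\<^sup>2)))"
    using assms by blast
  let ?C = "\<lambda>i. cball (real i / real N) (1 / (2 * (real N)\<^sup>2))"
  have "measure lebesgue (?C i) = 1 / (real N)\<^sup>2" for i
    by (simp add: cball_eq_atLeastAtMost)
  then have "measure lebesgue (\<Union>i\<le>N. ?C i) \<le> (\<Sum>i\<le>N. 1 / (real N)\<^sup>2)"
    using measure_UNION_le[of "{..N}" ?C lebesgue] by simp
  also have "\<dots> = (real N + 1) / (real N)\<^sup>2" by simp
  also have "\<dots> \<le> (2 * real N) / (real N)\<^sup>2"
    using N by (intro divide_right_mono) auto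
  also have "\<dots> = 2 / real N" by (simp add: power2_eq_square)
  also have "\<dots> \<le> 2 / real (Suc k)" using N by (intro divide_left_mono) auto
  finally have "measure lebesgue (\<Union>i\<le>N. ?C i) \<le> e" using k by linarith
  moreover have "(\<Union>i\<le>N. ?C i) \<in> lmeasurable"
    by (intro fmeasurable.finite_UN) auto
  ultimately show "\<exists>T. B \<subseteq> T \<and> T \<in> lmeasurable \<and> measure lebesgue T \<le> e"
    using B by blast
qed

section \<open>Trapping maps\<close>

lemma cell_antimono: "m \<le> m' \<Longrightarrow> cell N m' i \<subseteq> cell N m i"
  unfolding cell_def by auto

lemma trapping_orbits_share_cell:
  assumes "trapping N f" "i < N"
    and "x \<in> core N i" "y \<in> core N i"
  shows "\<exists>j<N. (f ^^ n) x \<in> core N j \<and> (f ^^ n) y \<in> core N j"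
proof (induction n)
  case 0
  then show ?case using assms by auto
next
  case (Suc n)
  then obtain j where j: "j < N" "(f ^^ n) x \<in> core N j"
    "(f ^^ n) y \<in> core N j" by blast
  from assms(1) obtain \<eta> where "\<eta> > 0" and \<eta>: "\<forall>i<N. \<exists>j<N.
     f ` core N i \<subseteq> cell N (1 / (2 * (real N)\<^sup>2) + \<eta>) j"
    unfolding trapping_def by blast
  from \<eta> j(1) obtain l where l: "l < N"
    "f ` core N j \<subseteq> cell N (1 / (2 * (real N)\<^sup>2) + \<eta>) l" by blast
  have "cell N (1 / (2 * (real N)\<^sup>2) + \<eta>) l \<subseteq> core N l"
    using \<open>\<eta> > 0\<close> by (intro cell_antimono) simp
  with l j show ?case by (intro exI[of _ l]) auto
qed

lemma trapping_future_ball_contains_cell: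
  assumes "trapping N f" "i < N" "1 / real N \<le> \<alpha>" and x: "x \<in> core N i"
  shows "core N i \<subseteq> {y \<in> {0..1}. \<forall>n. \<bar>(f ^^ n) x - (f ^^ n) y\<bar> < \<alpha>}"
proof safe
  fix y n assume y: "y \<in> core N i"
  show "y \<in> {0..1}" using cell_subset_unit[OF assms(2), of "1 / (2 * (real N)\<^sup>2)"] y by auto
  obtain j where j: "(f ^^ n) x \<in> core N j"
    "(f ^^ n) y \<in> core N j"
    using trapping_orbits_share_cell[OF assms(1,2) x y] by blast
  have "1 / (2 * (real N)\<^sup>2) > 0" using assms by simp
  with j have "\<bar>(f ^^ n) x - (f ^^ n) y\<bar> < 1 / real N"
    unfolding cell_def atLeastAtMost_iff add_divide_distrib by linarith
  then show "\<bar>(f ^^ n) x - (f ^^ n) y\<bar> < \<alpha>" using assms(3) by linarith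
qed

lemma emeasure_cell_pos:
  assumes "N \<ge> 2"
  shows "emeasure lebesgue (core N i) > 0"
proof -
  have "1 / (real N)\<^sup>2 < 1 / real N"
    using assms by (simp add: field_simps power2_eq_square)
  then have lt: "real i / real N + 1 / (2 * (real N)\<^sup>2) < (real i + 1) / real N - 1 / (2 * (real N)\<^sup>2)"
    by (simp add: add_divide_distrib)
  show ?thesis
    unfolding cell_def using lt by (simp add: less_imp_le)
qed

text \<open>
  For a fixed \<open>\<alpha>\<close>, a point is bad only if it avoids the cores of every grid with \<open>1/N \<le> \<alpha>\<close> for
  which \<open>f\<close> is trapping; so the bad points lie in the gaps of arbitrarily fine grids.
\<close>

lemma strongly_non_expansive_if_frequently_trapping:
  assumes f: "f \<in> mspace C01" and freq: "\<And>k. \<exists>N>k. trapping N f"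
  shows "strongly_non_expansive_future f"
  unfolding strongly_non_expansive_future_def
proof (intro allI impI)
  fix \<alpha> :: real assume "\<alpha> > 0"
  let ?ball = "\<lambda>x. {y \<in> {0..1}. \<forall>n. \<bar>(f ^^ n) x - (f ^^ n) y\<bar> < \<alpha>}"
  define B where "B = {x \<in> {0..1}. \<not> emeasure lebesgue (?ball x) > 0}"
  obtain k0 where k0: "1 / real (Suc k0) < \<alpha>"
    using reals_Archimedean[OF \<open>\<alpha> > 0\<close>] by (auto simp: inverse_eq_divide)
  have "\<exists>N>k. B \<subseteq> (\<Union>i\<le>N. cball (real i / real N) (1 / (2 * (real N)\<^sup>2)))" for k
  proof -
    obtain N where N: "N > max k (Suc k0)" "trapping N f" using freq by blast
    then have "1 / real N \<le> 1 / real (Suc k0)" by (intro divide_left_mono) auto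
    with k0 have \<alpha>: "1 / real N \<le> \<alpha>" by linarith
    have "x \<notin> B" if x: "i < N" "x \<in> core N i" for x i
    proof -
      have "0 < emeasure lebesgue (core N i)"
        using N by (intro emeasure_cell_pos) auto
      also have "\<dots> \<le> emeasure lebesgue (?ball x)"
        using trapping_future_ball_contains_cell[OF N(2) x(1) \<alpha> x(2)] future_ball_borel[OF f, of x \<alpha>]
        by (intro emeasure_mono) (auto simp: sets_completionI_sets)
      finally show ?thesis unfolding B_def by blast
    qed
    then have "B \<subseteq> (\<Union>i\<le>N. cball (real i / real N) (1 / (2 * (real N)\<^sup>2)))"
    proof (intro subsetI)
      fix x assume "x \<in> B"
      moreover from this have "x \<in> {0..1}" unfolding B_def by blast
      ultimately show "x \<in> (\<Union>i\<le>N. cball (real i / real N) (1 / (2 * (real N)\<^sup>2)))"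
        using unit_subset_cells_Un_gaps[of N "1 / (2 * (real N)\<^sup>2)" x] N(1)
          \<open>\<And>i x. i < N \<Longrightarrow> x \<in> core N i \<Longrightarrow> x \<notin> B\<close> by auto
    qed
    then show ?thesis using N(1) by (intro exI[of _ N]) auto
  qed
  then have "negligible B" by (rule negligible_if_covered_by_gaps)
  then have "AE x in lebesgue. x \<notin> B"
    by (intro AE_not_in) (simp add: negligible_iff_null_sets)
  then have "AE x in lebesgue. x \<in> {0..1} \<longrightarrow> emeasure lebesgue (?ball x) > 0"
    by eventually_elim (unfold B_def, blast)
  then show "AE x in lebesgue_on {0..1}. emeasure lebesgue (?ball x) > 0"
    by (subst AE_restrict_space_iff) auto
qed

section \<open>Genericity of trapping\<close>

lemma mdist_C01_le:
  assumes "0 \<le> B" "\<And>x. x \<in> {0..1} \<Longrightarrow> \<bar>f x - g x\<bar> \<le> B"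
  shows "mdist C01 f g \<le> B"
  using assms unfolding C01_def by (intro mdist_cfunspace_le) (auto simp: dist_real_def)

lemma abs_diff_le_mdist_C01:
  assumes "f \<in> mspace C01" "g \<in> mspace C01" "x \<in> {0..1}"
  shows "\<bar>f x - g x\<bar> \<le> mdist C01 f g"
  using mdist_cfunspace_imp_mdist_le[OF assms(1,2)[unfolded C01_def] order_refl, of x] assms(3)
  unfolding C01_def by (simp add: dist_real_def)

text \<open>
  Bounded continuous maps into a complete space form a complete space, and the compact interval is
  complete.
\<close>

lemma completely_metrizable_C01: "completely_metrizable_space (mtopology_of C01)"
proof -
  interpret I: Metric_space "{0..1} :: real set" dist
    by (intro Met_TC.subspace) simp
  have Self: "I.Self = submetric euclidean_metric {0..1}"
    unfolding I.Self_def submetric_def by simp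
  have "I.mtopology = top_of_set {0..1}"
    using mtopology_of_submetric[of euclidean_metric "{0..1::real}"]
    by (simp flip: Self add: I.Self_def)
  then have "I.mcomplete"
    by (intro I.compact_space_imp_mcomplete) (simp add: compact_space_subtopology)
  then have "mcomplete_of C01"
    unfolding C01_def Self[symmetric] by (rule I.mcomplete_cfunspace)
  then show ?thesis
    unfolding mcomplete_of_def mtopology_of_def
    by (intro Metric_space.completely_metrizable_space_mtopology) simp_all
qed

lemma openin_trapping:
  "openin (mtopology_of C01) {f \<in> mspace C01. trapping N f}"
proof -
  interpret Metric_space "mspace C01" "mdist C01" by simp
  have "\<exists>r>0. mball f r \<subseteq> {f \<in> mspace C01. trapping N f}"
    if f: "f \<in> mspace C01" "trapping N f" for f
  proof -
    from f(2) obtain \<eta> where "\<eta> > 0" and \<eta>: "\<forall>i<N. \<exists>j<N.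
       f ` core N i \<subseteq> cell N (1 / (2 * (real N)\<^sup>2) + \<eta>) j"
      unfolding trapping_def by blast
    have "trapping N g" if g: "g \<in> mspace C01" "mdist C01 f g < \<eta> / 2" for g
      unfolding trapping_def
    proof (intro exI[of _ "\<eta> / 2"] conjI allI impI)
      fix i assume i: "i < N"
      with \<eta> obtain j where j: "j < N"
        "f ` core N i \<subseteq> cell N (1 / (2 * (real N)\<^sup>2) + \<eta>) j" by blast
      have "g x \<in> cell N (1 / (2 * (real N)\<^sup>2) + \<eta> / 2) j"
        if x: "x \<in> core N i" for x
      proof -
        have "x \<in> {0..1}" using cell_subset_unit[OF i, of "1 / (2 * (real N)\<^sup>2)"] x by auto
        then have "\<bar>f x - g x\<bar> < \<eta> / 2"
          using abs_diff_le_mdist_C01[OF f(1) g(1)] g(2) by fastforce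
        moreover have "f x \<in> cell N (1 / (2 * (real N)\<^sup>2) + \<eta>) j" using j(2) x by blast
        ultimately show ?thesis unfolding cell_def atLeastAtMost_iff by argo
      qed
      with j(1) show "\<exists>j<N. g ` core N i
          \<subseteq> cell N (1 / (2 * (real N)\<^sup>2) + \<eta> / 2) j" by blast
    qed (use \<open>\<eta> > 0\<close> in simp)
    then show ?thesis using \<open>\<eta> > 0\<close> by (intro exI[of _ "\<eta> / 2"]) auto
  qed
  then show ?thesis unfolding mtopology_of_def openin_mtopology by blast
qed

lemma near_cell_center:
  assumes "0 < N" "y \<in> {0..1}"
  shows "\<exists>j<N. \<bar>y - (real j + 1 / 2) / real N\<bar> \<le> 1 / real N"
proof (cases "y = 1")
  case True
  have "\<bar>y - (real (N - 1) + 1 / 2) / real N\<bar> \<le> 1 / real N"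
    using assms True by (simp add: of_nat_diff field_simps)
  then show ?thesis using assms by (intro exI[of _ "N - 1"]) auto
next
  case False
  define j where "j = nat \<lfloor>real N * y\<rfloor>"
  have j: "real j \<le> real N * y" "real N * y < real j + 1"
    using assms unfolding j_def by (auto simp: of_nat_nat)
  have "real N * y < real N" using assms False by simp
  with j have "j < N" by linarith
  have "y - (real j + 1 / 2) / real N = (real N * y - (real j + 1 / 2)) / real N"
    using assms by (simp add: field_simps)
  also have "\<bar>\<dots>\<bar> \<le> 1 / real N"
    using j assms unfolding abs_divide by (simp add: divide_right_mono) 
  finally show ?thesis using \<open>j < N\<close> by blast
qed

text \<open>
  For \<open>N \<ge> 2\<close> the centre of a cell lies in the core with margin \<open>1/(4N)\<close> to spare, because
  \<open>1/(2N\<^sup>2) + 1/(4N) \<le> 1/(2N)\<close>.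
\<close>

lemma trapping_if_constant_on_cells:
  assumes "N \<ge> 2" and w: "\<And>i. i < N \<Longrightarrow> w i < N"
    and g: "\<And>i x. i < N \<Longrightarrow> x \<in> core N i \<Longrightarrow> g x = (real (w i) + 1 / 2) / real N"
  shows "trapping N g"
  unfolding trapping_def
proof (intro exI[of _ "1 / (4 * real N)"] conjI allI impI)
  fix i assume i: "i < N"
  have "1 / (2 * (real N)\<^sup>2) \<le> 1 / (4 * real N)"
    using assms(1) by (simp add: field_simps power2_eq_square)
  then have "(real (w i) + 1 / 2) / real N \<in> cell N (1 / (2 * (real N)\<^sup>2) + 1 / (4 * real N)) (w i)"
    unfolding cell_def by (auto simp: add_divide_distrib)
  with w[OF i] g[OF i] show "\<exists>j<N. g ` core N i
       \<subseteq> cell N (1 / (2 * (real N)\<^sup>2) + 1 / (4 * real N)) j" by auto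
qed (use assms(1) in simp)

text \<open>
  On the core with centre \<open>c i\<close> the new map has the value \<open>c (w i)\<close>, a cell centre next to \<open>f (c i)\<close>.
  To interpolate in the gaps, Tietze's theorem extends the difference to \<open>f\<close> from the closed union
  of the cores to \<open>[0,1]\<close> without enlarging its norm; adding it to \<open>f\<close> and truncating to \<open>[0,1]\<close>
  gives the new map.
\<close>

lemma trapping_approximation:
  assumes f: "f \<in> mspace C01" and "e > 0"
  obtains N g where "N > k" "g \<in> mspace C01" "trapping N g" "mdist C01 f g < e"
proof -
  have fc: "continuous_on {0..1} f" and fm: "f \<in> {0..1} \<rightarrow> {0..1}"
    using f by (auto simp: mspace_C01)
  have "uniformly_continuous_on {0..1} f"
    using fc by (intro compact_uniformly_continuous) auto
  then obtain d where "d > 0"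
    and d: "\<And>x y. x \<in> {0..1} \<Longrightarrow> y \<in> {0..1} \<Longrightarrow> \<bar>y - x\<bar> < d \<Longrightarrow> \<bar>f y - f x\<bar> < e / 3"
    unfolding uniformly_continuous_on_def dist_real_def using \<open>e > 0\<close>
    by (metis zero_less_divide_iff zero_less_numeral)
  obtain n where n: "1 / real (Suc n) < min d (e / 3)"
    using reals_Archimedean[of "min d (e / 3)"] \<open>d > 0\<close> \<open>e > 0\<close> by (auto simp: inverse_eq_divide)
  (* The grid must be finer than the modulus of continuity d, finer than e/3, which bounds the
     rounding of values to cell centres, and must have more than k cells; two cells are the least that
     leave nondegenerate cores. *)
  define N where "N = Suc (Suc n) + k"
  have N: "N \<ge> 2" "N > k" unfolding N_def by auto
  have "1 / real N \<le> 1 / real (Suc n)" unfolding N_def by (intro divide_left_mono) auto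
  with n have Nd: "1 / real N < d" and Ne: "1 / real N < e / 3" by linarith+
  let ?K = "core N"
  have m: "1 / (2 * (real N)\<^sup>2) > 0" using N by simp
  define c where "c i = (real i + 1 / 2) / real N" for i
  have cpos: "c i \<in> {0..1}" "c i \<in> cell N 0 i" if "i < N" for i
  proof -
    show "c i \<in> cell N 0 i"
      using N unfolding cell_def c_def by (auto simp: divide_right_mono)
    with cell_subset_unit[OF that, of 0] show "c i \<in> {0..1}" by auto
  qed
  have "\<forall>i. \<exists>j. i < N \<longrightarrow> j < N \<and> \<bar>f (c i) - c j\<bar> \<le> 1 / real N"
    using near_cell_center[of N] fm cpos N unfolding c_def by (auto simp: Pi_iff)
  then obtain w where w: "\<And>i. i < N \<Longrightarrow> w i < N" "\<And>i. i < N \<Longrightarrow> \<bar>f (c i) - c (w i)\<bar> \<le> 1 / real N"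
    by metis
  define v where "v x = c (w (nat \<lfloor>real N * x\<rfloor>))" for x
  have v: "v x = c (w i)" if "x \<in> ?K i" for x i
    using floor_of_mem_cell[OF that] N m unfolding v_def by simp
  define S where "S = (\<Union>i<N. ?K i)"
  have KU: "?K i \<subseteq> {0..1}" if "i < N" for i using cell_subset_unit[OF that] m by simp
  have contS: "continuous_on S (\<lambda>x. v x - f x)"
    unfolding S_def
  proof (rule continuous_on_closed_Union)
    fix i assume "i \<in> {..<N}"
    then have "continuous_on (?K i) (\<lambda>x. c (w i) - f x)"
      using KU fc by (intro continuous_intros) (auto intro: continuous_on_subset)
    then show "continuous_on (?K i) (\<lambda>x. v x - f x)"
      by (rule continuous_on_eq) (simp add: v)
  qed (auto simp: cell_def)
  have closedS: "closedin (top_of_set {0..1}) S"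
  proof (rule closed_subset)
    show "S \<subseteq> {0..1}" unfolding S_def using KU by blast
    show "closed S" unfolding S_def by (intro closed_UN) (auto simp: cell_def)
  qed
  have B: "0 \<le> 2 * e / 3" using \<open>e > 0\<close> by simp
  have bound: "norm (v x - f x) \<le> 2 * e / 3" if xS: "x \<in> S" for x
  proof -
    obtain i where i: "i < N" "x \<in> ?K i" using xS unfolding S_def by blast
    have "x \<in> cell N 0 i" using i(2) cell_antimono[of 0 "1 / (2 * (real N)\<^sup>2)" N i] by auto
    then have "\<bar>c i - x\<bar> \<le> 1 / real N"
      using cpos(2)[OF i(1)] unfolding cell_def by (auto simp: add_divide_distrib)
    moreover have "x \<in> {0..1}" using KU[OF i(1)] i(2) by blast
    ultimately have "\<bar>f (c i) - f x\<bar> < e / 3" using Nd cpos(1)[OF i(1)] by (intro d) auto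
    with w(2)[OF i(1)] Ne v[OF i(2)] show ?thesis unfolding real_norm_def by argo
  qed
  obtain h where h: "continuous_on {0..1} h" "\<And>x. x \<in> S \<Longrightarrow> h x = v x - f x"
    "\<And>x. x \<in> {0..1} \<Longrightarrow> norm (h x) \<le> 2 * e / 3"
    using Tietze[OF contS closedS B bound] by blast
  (* Truncation keeps the distance to f, as f has values in the unit interval, and keeps the values
     on the cores, which are cell centres.  The restriction makes g extensional. *)
  define g where "g = restrict (\<lambda>x. max 0 (min 1 (f x + h x))) {0..1}"
  have "continuous_on {0..1} (\<lambda>x. max 0 (min 1 (f x + h x)))"
    using fc h(1) by (intro continuous_intros)
  then have "continuous_on {0..1} g"
    by (rule continuous_on_eq) (simp add: g_def)
  then have "g \<in> mspace C01"
    unfolding mspace_C01 by (auto simp: g_def)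
  moreover have "trapping N g"
  proof (rule trapping_if_constant_on_cells[OF N(1) w(1)])
    fix i x assume i: "i < N" and x: "x \<in> ?K i"
    then have "x \<in> S" "x \<in> {0..1}" using KU[OF i] unfolding S_def by blast+
    then show "g x = (real (w i) + 1 / 2) / real N"
      using h(2) v[OF x] cpos(1)[OF w(1)[OF i]] unfolding g_def c_def by auto
  qed
  moreover have "mdist C01 f g \<le> 2 * e / 3"
  proof (rule mdist_C01_le)
    fix x :: real assume x: "x \<in> {0..1}"
    with fm have "0 \<le> f x" "f x \<le> 1" by auto
    then have "\<bar>f x - max 0 (min 1 (f x + h x))\<bar> \<le> \<bar>h x\<bar>" by linarith
    with h(3)[OF x] x show "\<bar>f x - g x\<bar> \<le> 2 * e / 3" unfolding g_def by simp
  qed (use \<open>e > 0\<close> in simp)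
  moreover have "2 * e / 3 < e" using \<open>e > 0\<close> by simp
  ultimately show ?thesis using that[OF N(2)] by force
qed

theorem corollary9:
  shows "typical (mtopology_of C01) strongly_non_expansive_future"
proof -
  interpret Metric_space "mspace C01" "mdist C01" by simp
  define D where "D k = (\<Union>N\<in>{k<..}. {f \<in> mspace C01. trapping N f})" for k
  have op: "openin (mtopology_of C01) (D k)" for k
    unfolding D_def using openin_trapping by blast
  have dense: "mtopology_of C01 closure_of D k = mspace C01" for k
  proof -
    have "\<exists>g\<in>D k. g \<in> mball f e" if f: "f \<in> mspace C01" and e: "e > 0" for f e
    proof -
      obtain N g where "N > k" "g \<in> mspace C01" "trapping N g" "mdist C01 f g < e"
        using trapping_approximation[OF f e] .
      with f show ?thesis unfolding D_def by (intro bexI[of _ g]) auto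
    qed
    then show ?thesis unfolding mtopology_of_def metric_closure_of by auto
  qed
  show ?thesis
    unfolding typical_def
  proof (intro exI[of _ "\<Inter>(range D)"] conjI ballI)
    show "gdelta_in (mtopology_of C01) (\<Inter>(range D))"
      using op by (intro gdelta_in_Inter) (auto intro: open_imp_gdelta_in)
    show "mtopology_of C01 closure_of \<Inter>(range D) = topspace (mtopology_of C01)"
      using op dense completely_metrizable_C01 by (intro Baire_category) auto
    fix f assume f: "f \<in> \<Inter>(range D)"
    then show "strongly_non_expansive_future f"
      by (intro strongly_non_expansive_if_frequently_trapping) (auto simp: D_def)
  qed
qed

end
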